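(* Let $c>0$ and let $v$ be a constant with $0<v\le c$. Let $\gamma_0,\gamma_1,\gamma_2,\gamma_3$ be constant $4\times 4$ complex matrices with $\gamma_a\gamma_b+\gamma_b\gamma_a=2\eta_{ab}I$, $\eta=\mathrm{diag}(1,-1,-1,-1)$, let $\frac{d\tau}{dt}$ be the constant determined by a motion of speed $v$ (so $\left(\frac{d\tau}{dt}\right)^2=1-\frac{v^2}{c^2}$), and put $$\gamma'_i=\frac{c}{v}\left(\gamma_0+\frac{d\tau}{dt}I\right)\gamma_i,\qquad (\gamma')^i=\gamma'_i,\qquad i=1,2,3 .$$ Let $\psi=\psi(t,x^1,x^2,x^3)$ be a twice continuously differentiable $\mathbb{C}^4$-valued function satisfying the first-order wave equation $$\frac{1}{v}\frac{\partial\psi}{\partial t}=-\sum_{i=1}^{3}(\gamma')^i\frac{\partial\psi}{\partial x^i}.$$ Then $$0=\frac{1}{v^2}\frac{\partial^2\psi}{\partial t^2}-\sum_{i=1}^{3}\frac{\partial^2\psi}{\partial (x^i)^2}.$$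
   Context: A particle moves in Minkowski space with laboratory coordinates $(t,x^1,x^2,x^3)$, speed $v=\left(\sum_i (dx^i/dt)^2\right)^{1/2}$, and proper time $\tau$ defined by $c^2d\tau^2=c^2dt^2-\sum_{i=1}^3(dx^i)^2$. Scalars are identified with multiples of the identity matrix $I$. *)

theory Defs
  imports "HOL-Analysis.Analysis"
begin

text \<open>
  Spacetime points are vectors \<open>p :: real ^ 4\<close> of laboratory coordinates. The index type \<open>4\<close> is
  that of residues modulo 4, so its elements are \<open>0, 1, 2, 3\<close>: \<open>p $ 0\<close> is the time \<open>t\<close> itself
  (not \<open>c t\<close>), and \<open>p $ i\<close> is \<open>x\<^sup>i\<close> for \<open>i \<in> spatial = {1, 2, 3}\<close>.
\<close>

definition spatial :: "4 set" where
  "spatial = {1, 2, 3}"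

definition minkowski :: "4 \<Rightarrow> 4 \<Rightarrow> complex" where
  "minkowski a b = (if a \<noteq> b then 0 else if a = 0 then 1 else - 1)"

definition dirac_matrices :: "(4 \<Rightarrow> complex ^ 4 ^ 4) \<Rightarrow> bool" where
  "dirac_matrices \<gamma> \<longleftrightarrow> (\<forall>a b. \<gamma> a ** \<gamma> b + \<gamma> b ** \<gamma> a = mat (2 * minkowski a b))"

text \<open>A motion \<open>X\<close> gives the spatial position as a function of the laboratory time.\<close>

definition speed :: "(real \<Rightarrow> real ^ 3) \<Rightarrow> real \<Rightarrow> real" where
  "speed X t = sqrt (\<Sum>i\<in>UNIV. (deriv (\<lambda>s. X s $ i) t)\<^sup>2)"

text \<open>
  The defining relation \<open>c\<^sup>2 d\<tau>\<^sup>2 = c\<^sup>2 dt\<^sup>2 - \<Sum>\<^sub>i (dx\<^sup>i)\<^sup>2\<close>, divided by \<open>dt\<^sup>2\<close>. It leaves the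
  sign of \<open>d\<tau>/dt\<close> open.
\<close>

definition proper_time :: "real \<Rightarrow> (real \<Rightarrow> real ^ 3) \<Rightarrow> (real \<Rightarrow> real) \<Rightarrow> bool" where
  "proper_time c X \<tau> \<longleftrightarrow>
     (\<forall>t. \<tau> differentiable at t \<and>
          c\<^sup>2 * (deriv \<tau> t)\<^sup>2 = c\<^sup>2 - (\<Sum>i\<in>UNIV. (deriv (\<lambda>s. X s $ i) t)\<^sup>2))"

text \<open>
  The real parameter \<open>\<sigma>\<close> stands for \<open>d\<tau>/dt\<close>. The matrices with raised index are by convention
  the same matrices; the index is not raised with the Minkowski metric.
\<close>

definition gamma_prime ::
    "real \<Rightarrow> real \<Rightarrow> real \<Rightarrow> (4 \<Rightarrow> complex ^ 4 ^ 4) \<Rightarrow> 4 \<Rightarrow> complex ^ 4 ^ 4" where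
  "gamma_prime c v \<sigma> \<gamma> i = (c / v) *\<^sub>R ((\<gamma> 0 + mat (complex_of_real \<sigma>)) ** \<gamma> i)"

definition partial :: "4 \<Rightarrow> (real ^ 4 \<Rightarrow> complex ^ 4) \<Rightarrow> real ^ 4 \<Rightarrow> complex ^ 4" where
  "partial a \<psi> p = vector_derivative (\<lambda>h. \<psi> (p + h *\<^sub>R axis a 1)) (at 0)"

definition twice_continuously_differentiable ::
    "('a::real_normed_vector \<Rightarrow> 'b::real_normed_vector) \<Rightarrow> bool" where
  "twice_continuously_differentiable f \<longleftrightarrow>
     (\<exists>(D :: 'a \<Rightarrow> 'a \<Rightarrow>\<^sub>L 'b) (D2 :: 'a \<Rightarrow> 'a \<Rightarrow>\<^sub>L 'a \<Rightarrow>\<^sub>L 'b).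
        (\<forall>p. (f has_derivative blinfun_apply (D p)) (at p)) \<and>
        (\<forall>p. (D has_derivative blinfun_apply (D2 p)) (at p)) \<and>
        continuous_on UNIV D2)"

end

theory Submission
  imports Defs
begin

text \<open>Write \<open>M i\<close> for \<open>gamma_prime c v \<sigma> \<gamma> i\<close>. These
  matrices are constant, so applying the first-order equation twice expresses v^-2 times the second
  time derivative of \<psi> as the double sum over spatial i, j of \<open>M i ** M j\<close> applied
  to the mixed derivative of \<psi> in i and j. On the way the order of the t- and x-derivatives is
  exchanged (\<open>second_derivative_symmetric\<close>). The mixed derivatives are symmetric in i
  and j, so only the anticommutators of the \<open>M i\<close> contribute
  (\<open>anticommuting_square_sum\<close>).

  By \<open>gamma_prime_mult\<close> the products \<open>M i ** M j\<close> equal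
  \<open>- (\<gamma> i ** \<gamma> j)\<close>; here the relation between \<open>\<sigma>\<close> and
  \<open>v\<close> makes the prefactor c/v cancel. The anticommutators are therefore -2 times the
  spatial Minkowski metric, that is, 2 for i = j and 0 otherwise
  (\<open>gamma_prime_anticommute\<close>), and the double sum collapses to the Laplacian.\<close>

section \<open>Symmetry of the second derivative\<close>

text \<open>The mean value inequality along the segment from 0 to u reduces the second difference of
  f to an increment of \<open>D\<close> in direction w. Since \<open>D\<close> is controlled only
  around p, both ends of that increment are compared with \<open>D p\<close>, which costs the factor
  2.\<close>

lemma second_difference_bound:
  fixes f :: "'a::real_normed_vector \<Rightarrow> 'b::real_normed_vector"
    and D :: "'a \<Rightarrow> 'a \<Rightarrow>\<^sub>L 'b" and D2 :: "'a \<Rightarrow>\<^sub>L 'a \<Rightarrow>\<^sub>L 'b"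
  assumes f: "\<And>x. (f has_derivative D x) (at x)"
    and D: "\<And>h. norm h < \<delta> \<Longrightarrow> norm (D (p + h) - D p - D2 h) \<le> \<epsilon> * norm h"
    and small: "norm u + norm w < \<delta>" and "\<epsilon> \<ge> 0"
  shows "norm (f (p + u + w) - f (p + u) - f (p + w) + f p - D2 w u)
           \<le> 2 * \<epsilon> * (norm u + norm w)\<^sup>2"
proof -
  define k where "k t = f (p + w + t *\<^sub>R u) - f (p + t *\<^sub>R u) - t *\<^sub>R D2 w u" for t :: real
  define k' where "k' t h = h *\<^sub>R (D (p + w + t *\<^sub>R u) u - D (p + t *\<^sub>R u) u - D2 w u)" for t h :: real
  let ?r = "norm u + norm w"
  have line: "((\<lambda>t. f (q + t *\<^sub>R u)) has_derivative (\<lambda>h. h *\<^sub>R D (q + t *\<^sub>R u) u)) (at t within S)"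
    for q and t :: real and S
    by (rule has_derivative_eq_rhs,
        rule has_derivative_compose[of "\<lambda>t. q + t *\<^sub>R u" "\<lambda>h. h *\<^sub>R u", OF _ f])
       (auto intro!: derivative_eq_intros simp: blinfun.scaleR_right)
  \<comment> \<open>\<open>k 1 - k 0\<close> is the second difference minus \<open>D2 w u\<close>,
    so a bound on the derivative of \<open>k\<close> suffices.\<close>
  have "norm (k 1 - k 0) \<le> (2 * \<epsilon> * ?r * norm u) * norm (1 - 0 :: real)"
  proof (rule differentiable_bound[of "{0..1}" k k'])
    fix t :: real assume t: "t \<in> {0..1}"
    show "(k has_derivative k' t) (at t within {0..1})"
      unfolding k_def[abs_def] k'_def[abs_def]
      unfolding scaleR_diff_right by (intro derivative_intros line)
    have tu: "norm (t *\<^sub>R u) \<le> norm u"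
      using t by (auto intro: mult_left_le_one_le)
    have twu: "norm (w + t *\<^sub>R u) \<le> ?r"
      using norm_triangle_ineq[of w "t *\<^sub>R u"] tu by linarith
    have "norm (D (p + (w + t *\<^sub>R u)) - D p - D2 (w + t *\<^sub>R u)) \<le> \<epsilon> * norm (w + t *\<^sub>R u)"
      using twu small by (intro D) linarith
    also have "\<dots> \<le> \<epsilon> * ?r"
      using twu \<open>\<epsilon> \<ge> 0\<close> by (rule mult_left_mono)
    finally have A: "norm (D (p + (w + t *\<^sub>R u)) - D p - D2 (w + t *\<^sub>R u)) \<le> \<epsilon> * ?r" .
    have "norm (D (p + t *\<^sub>R u) - D p - D2 (t *\<^sub>R u)) \<le> \<epsilon> * norm (t *\<^sub>R u)"
      using tu small norm_ge_zero[of w] by (intro D) linarith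
    also have "\<dots> \<le> \<epsilon> * ?r"
      using tu norm_ge_zero[of w] \<open>\<epsilon> \<ge> 0\<close> by (intro mult_left_mono) linarith+
    finally have B: "norm (D (p + t *\<^sub>R u) - D p - D2 (t *\<^sub>R u)) \<le> \<epsilon> * ?r" .
    \<comment> \<open>By linearity the two contributions \<open>D2 (t *\<^sub>R u)\<close> cancel
      and only \<open>D2 w\<close> remains.\<close>
    have "D (p + w + t *\<^sub>R u) - D (p + t *\<^sub>R u) - D2 w =
        (D (p + (w + t *\<^sub>R u)) - D p - D2 (w + t *\<^sub>R u)) - (D (p + t *\<^sub>R u) - D p - D2 (t *\<^sub>R u))"
      by (simp add: blinfun.add_right add.assoc)
    moreover have "\<epsilon> * ?r + \<epsilon> * ?r = 2 * \<epsilon> * ?r"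
      by simp
    ultimately have C: "norm (D (p + w + t *\<^sub>R u) - D (p + t *\<^sub>R u) - D2 w) \<le> 2 * \<epsilon> * ?r"
      using norm_triangle_le_diff[OF add_mono[OF A B]] by (simp only:)
    have "norm (D (p + w + t *\<^sub>R u) u - D (p + t *\<^sub>R u) u - D2 w u)
        = norm ((D (p + w + t *\<^sub>R u) - D (p + t *\<^sub>R u) - D2 w) u)"
      by (simp add: blinfun.diff_left)
    also have "\<dots> \<le> 2 * \<epsilon> * ?r * norm u"
      using norm_blinfun mult_right_mono[OF C norm_ge_zero] by (rule order_trans)
    finally have bound: "norm (D (p + w + t *\<^sub>R u) u - D (p + t *\<^sub>R u) u - D2 w u) \<le> 2 * \<epsilon> * ?r * norm u" .
    show "onorm (k' t) \<le> 2 * \<epsilon> * ?r * norm u"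
    proof (rule onorm_le)
      fix h :: real
      have "norm (k' t h) \<le> \<bar>h\<bar> * (2 * \<epsilon> * ?r * norm u)"
        unfolding k'_def norm_scaleR using bound by (rule mult_left_mono) simp
      then show "norm (k' t h) \<le> 2 * \<epsilon> * ?r * norm u * norm h"
        by (simp only: real_norm_def mult.commute)
    qed
  qed auto
  also have "\<dots> \<le> 2 * \<epsilon> * ?r * ?r"
    using \<open>\<epsilon> \<ge> 0\<close> by (auto intro!: mult_left_mono)
  finally show ?thesis
    by (simp add: k_def power2_eq_square algebra_simps)
qed

text \<open>
  The second difference bounded above is symmetric in \<open>u\<close> and \<open>w\<close>, whence its limit
  after division by \<open>s\<^sup>2\<close> is too.
\<close>
lemma second_derivative_symmetric:
  fixes f :: "'a::real_normed_vector \<Rightarrow> 'b::real_normed_vector"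
    and D :: "'a \<Rightarrow> 'a \<Rightarrow>\<^sub>L 'b" and D2 :: "'a \<Rightarrow>\<^sub>L 'a \<Rightarrow>\<^sub>L 'b"
  assumes f: "\<And>x. (f has_derivative D x) (at x)"
    and D: "(D has_derivative D2) (at p)"
  shows "D2 u w = D2 w u"
proof -
  let ?r = "norm u + norm w"
  have bound: "norm (D2 w u - D2 u w) \<le> \<epsilon> * (4 * ?r\<^sup>2)" if "\<epsilon> > 0" for \<epsilon>
  proof -
    obtain \<delta> where "\<delta> > 0"
      and *: "\<And>y. norm (y - p) < \<delta> \<Longrightarrow> norm (D y - D p - D2 (y - p)) \<le> \<epsilon> * norm (y - p)"
      using D \<open>\<epsilon> > 0\<close> unfolding has_derivative_at_alt by blast
    have D': "norm (D (p + h) - D p - D2 h) \<le> \<epsilon> * norm h" if "norm h < \<delta>" for h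
      using *[of "p + h"] that by simp
    \<comment> \<open>Shrinks u and w into the ball of radius \<delta>; the summand 1 covers the
      case that both vanish.\<close>
    define s where "s = \<delta> / (?r + 1)"
    have r: "?r \<ge> 0" "?r + 1 > 0"
      using norm_ge_zero[of u] norm_ge_zero[of w] by linarith+
    have "s > 0"
      using \<open>\<delta> > 0\<close> r by (simp add: s_def)
    have "s * ?r < \<delta>"
      using \<open>\<delta> > 0\<close> r by (simp add: s_def field_simps)
    then have small: "norm (s *\<^sub>R u) + norm (s *\<^sub>R w) < \<delta>" "norm (s *\<^sub>R w) + norm (s *\<^sub>R u) < \<delta>"
      using \<open>s > 0\<close> by (simp_all add: algebra_simps)
    let ?\<Delta> = "f (p + s *\<^sub>R u + s *\<^sub>R w) - f (p + s *\<^sub>R u) - f (p + s *\<^sub>R w) + f p"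
    have R: "(norm (s *\<^sub>R u) + norm (s *\<^sub>R w))\<^sup>2 = s\<^sup>2 * ?r\<^sup>2"
      using \<open>s > 0\<close> by (simp add: power_mult_distrib flip: distrib_left)
    have A: "norm (?\<Delta> - s\<^sup>2 *\<^sub>R D2 w u) \<le> 2 * \<epsilon> * (s\<^sup>2 * ?r\<^sup>2)"
      using second_difference_bound[OF f D' small(1)] \<open>\<epsilon> > 0\<close>
      unfolding R by (simp add: blinfun.scaleR_left blinfun.scaleR_right power2_eq_square)
    have swap: "f (p + s *\<^sub>R w + s *\<^sub>R u) - f (p + s *\<^sub>R w) - f (p + s *\<^sub>R u) + f p = ?\<Delta>"
      by (simp add: algebra_simps)
    have B: "norm (?\<Delta> - s\<^sup>2 *\<^sub>R D2 u w) \<le> 2 * \<epsilon> * (s\<^sup>2 * ?r\<^sup>2)"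
      using second_difference_bound[OF f D' small(2)] \<open>\<epsilon> > 0\<close>
      unfolding swap add.commute[of "norm (s *\<^sub>R w)"] R
      by (simp add: blinfun.scaleR_left blinfun.scaleR_right power2_eq_square)
    \<comment> \<open>Both estimates concern the same \<open>?\<Delta>\<close>, so it drops out;
      their errors 2 + 2 give the 4, and \<open>s\<^sup>2\<close> cancels.\<close>
    have "s\<^sup>2 * norm (D2 w u - D2 u w) = norm ((?\<Delta> - s\<^sup>2 *\<^sub>R D2 u w) - (?\<Delta> - s\<^sup>2 *\<^sub>R D2 w u))"
      by (simp flip: scaleR_diff_right)
    also have "\<dots> \<le> s\<^sup>2 * (\<epsilon> * (4 * ?r\<^sup>2))"
      using norm_triangle_ineq4[of "?\<Delta> - s\<^sup>2 *\<^sub>R D2 u w" "?\<Delta> - s\<^sup>2 *\<^sub>R D2 w u"] A B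
      by (simp add: algebra_simps)
    finally show ?thesis
      using \<open>s > 0\<close> by simp
  qed
  \<comment> \<open>The bound is used with \<epsilon> equal to e divided by
    \<open>4 * ?r\<^sup>2 + 1\<close>, where the 1 keeps the divisor positive.\<close>
  have "norm (D2 w u - D2 u w) \<le> 0 + e" if "e > 0" for e :: real
  proof -
    have q: "4 * ?r\<^sup>2 + 1 > 0"
      by (intro add_nonneg_pos) simp_all
    then have "norm (D2 w u - D2 u w) \<le> e / (4 * ?r\<^sup>2 + 1) * (4 * ?r\<^sup>2)"
      using \<open>e > 0\<close> by (intro bound) simp
    also have "\<dots> \<le> e"
      using q \<open>e > 0\<close> by (simp add: field_simps)
    finally show ?thesis
      by simp
  qed
  then have "norm (D2 w u - D2 u w) \<le> 0"
    by (rule field_le_epsilon)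
  then show ?thesis
    by simp
qed

section \<open>Partial derivatives as values of the total derivative\<close>

lemma partial_eq:
  assumes \<psi>: "(\<psi> has_derivative \<psi>') (at p)"
  shows "partial a \<psi> p = \<psi>' (axis a 1)"
proof -
  let ?line = "\<lambda>h::real. p + h *\<^sub>R axis a 1"
  have "(?line has_vector_derivative axis a 1) (at 0)"
    unfolding has_vector_derivative_def
    by (rule has_derivative_eq_rhs, (rule derivative_intros)+) simp
  moreover have "(\<psi> has_derivative \<psi>') (at (?line 0) within range ?line)"
    using \<psi> by (simp add: has_derivative_at_withinI)
  ultimately have "(\<psi> \<circ> ?line has_vector_derivative \<psi>' (axis a 1)) (at 0)"
    by (rule vector_derivative_diff_chain_within)
  then show ?thesis
    unfolding partial_def comp_def by (rule vector_derivative_at)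
qed

section \<open>Matrix algebra and the Clifford relations\<close>

lemma mat_matrix_mult: "mat a ** A = (\<chi> i j. a * A $ i $ j)"
  for A :: "'a::semiring_1 ^ 'm ^ 'n"
  by (simp add: matrix_matrix_mult_def mat_def vec_eq_iff mult_delta_left)

lemma matrix_mult_mat: "A ** mat a = (\<chi> i j. A $ i $ j * a)"
  for A :: "'a::semiring_1 ^ 'm ^ 'n"
  by (simp add: matrix_matrix_mult_def mat_def vec_eq_iff mult_delta_right)

lemma matrix_diff_ldistrib: "A ** (B - C) = A ** B - A ** C"
  for A :: "'a::ring_1 ^ 'n ^ 'm" and B C :: "'a ^ 'p ^ 'n"
  by (simp add: matrix_matrix_mult_def vec_eq_iff right_diff_distrib sum_subtractf)

lemma matrix_add_rdistrib: "(B + C) ** A = B ** A + C ** A"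
  for A :: "'a::semiring_1 ^ 'p ^ 'n" and B C :: "'a ^ 'n ^ 'm"
  by (simp add: matrix_matrix_mult_def vec_eq_iff distrib_right sum.distrib)

lemma matrix_diff_rdistrib: "(B - C) ** A = B ** A - C ** A"
  for A :: "'a::ring_1 ^ 'p ^ 'n" and B C :: "'a ^ 'n ^ 'm"
  by (simp add: matrix_matrix_mult_def vec_eq_iff left_diff_distrib sum_subtractf)

lemma matrix_vector_mult_scaleR_right: "A *v (r *\<^sub>R x) = r *\<^sub>R (A *v x)"
  for A :: "'a::real_algebra_1 ^ 'n ^ 'm"
  by (rule linear_cmul) simp

text \<open>
  Because \<open>\<gamma>\<^sub>i\<close> anticommutes with \<open>\<gamma>\<^sub>0\<close>, moving it past the factor \<open>\<gamma>\<^sub>0 + \<sigma>\<close> turns that factor into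
  \<open>\<sigma> - \<gamma>\<^sub>0\<close>, and \<open>(\<gamma>\<^sub>0 + \<sigma>) (\<sigma> - \<gamma>\<^sub>0) = \<sigma>\<^sup>2 - 1 = - v\<^sup>2 / c\<^sup>2\<close>.
\<close>
lemma gamma_prime_mult:
  assumes \<gamma>: "dirac_matrices \<gamma>" and "i \<noteq> 0" and "c > 0" "v > 0"
    and \<sigma>: "c\<^sup>2 * \<sigma>\<^sup>2 = c\<^sup>2 - v\<^sup>2"
  shows "gamma_prime c v \<sigma> \<gamma> i ** gamma_prime c v \<sigma> \<gamma> j = - (\<gamma> i ** \<gamma> j)"
proof -
  define S where "S = (mat (complex_of_real \<sigma>) :: complex ^ 4 ^ 4)"
  have comm: "A ** S = S ** A" for A
    by (simp add: S_def mat_matrix_mult matrix_mult_mat mult.commute)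
  have anti: "\<gamma> i ** \<gamma> 0 = - (\<gamma> 0 ** \<gamma> i)"
    using \<gamma> \<open>i \<noteq> 0\<close> by (simp add: dirac_matrices_def minkowski_def eq_neg_iff_add_eq_0)
  have "\<gamma> 0 ** \<gamma> 0 + \<gamma> 0 ** \<gamma> 0 = mat 2"
    using \<gamma> by (simp add: dirac_matrices_def minkowski_def)
  then have "2 *\<^sub>R (\<gamma> 0 ** \<gamma> 0) = 2 *\<^sub>R mat 1"
    by (simp add: scaleR_2 mat_def vec_eq_iff)
  then have sq: "\<gamma> 0 ** \<gamma> 0 = mat 1"
    by simp
  have "(\<gamma> 0 + S) ** (S - \<gamma> 0) = S ** S - \<gamma> 0 ** \<gamma> 0"
    by (simp add: matrix_add_rdistrib matrix_diff_ldistrib comm[of "\<gamma> 0"])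
  also have "\<dots> = (\<sigma>\<^sup>2 - 1) *\<^sub>R mat 1"
    unfolding sq S_def mat_matrix_mult
    by (simp add: vec_eq_iff mat_def power2_eq_square of_real_def algebra_simps)
  finally have norm: "(\<gamma> 0 + S) ** (S - \<gamma> 0) = (\<sigma>\<^sup>2 - 1) *\<^sub>R mat 1" .
  have swap: "\<gamma> i ** (\<gamma> 0 + S) = (S - \<gamma> 0) ** \<gamma> i"
    by (simp add: matrix_add_ldistrib matrix_diff_rdistrib comm[of "\<gamma> i"] anti)
  have "((\<gamma> 0 + S) ** \<gamma> i) ** ((\<gamma> 0 + S) ** \<gamma> j) = (\<gamma> 0 + S) ** (\<gamma> i ** (\<gamma> 0 + S)) ** \<gamma> j"
    by (simp only: matrix_mul_assoc)
  also have "\<dots> = ((\<gamma> 0 + S) ** (S - \<gamma> 0)) ** (\<gamma> i ** \<gamma> j)"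
    by (simp only: swap matrix_mul_assoc)
  also have "\<dots> = (\<sigma>\<^sup>2 - 1) *\<^sub>R (\<gamma> i ** \<gamma> j)"
    by (simp only: norm matrix_mul_lid flip: scalar_matrix_assoc)
  finally have prod: "((\<gamma> 0 + S) ** \<gamma> i) ** ((\<gamma> 0 + S) ** \<gamma> j) = (\<sigma>\<^sup>2 - 1) *\<^sub>R (\<gamma> i ** \<gamma> j)" .
  \<comment> \<open>The relation for \<open>\<sigma>\<close> says that
    \<open>c\<^sup>2 * (\<sigma>\<^sup>2 - 1)\<close> is \<open>- v\<^sup>2\<close>.\<close>
  have "(c / v)\<^sup>2 * (\<sigma>\<^sup>2 - 1) = -1"
    using \<sigma> \<open>v > 0\<close> by (simp add: power_divide divide_simps right_diff_distrib)
  then show ?thesis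
    by (simp add: gamma_prime_def matrix_scalar_ac prod power2_eq_square mult.assoc
        flip: S_def scalar_matrix_assoc)
qed

text \<open>The minus sign in \<open>gamma_prime_mult\<close> reverses the negative spatial part of
  the Minkowski metric: the new matrices obey the Clifford relations of Euclidean space.\<close>

lemma gamma_prime_anticommute:
  assumes "dirac_matrices \<gamma>" "i \<noteq> 0" "j \<noteq> 0" "c > 0" "v > 0" "c\<^sup>2 * \<sigma>\<^sup>2 = c\<^sup>2 - v\<^sup>2"
  shows "gamma_prime c v \<sigma> \<gamma> i ** gamma_prime c v \<sigma> \<gamma> j +
         gamma_prime c v \<sigma> \<gamma> j ** gamma_prime c v \<sigma> \<gamma> i = mat (if i = j then 2 else 0)"
proof -
  have "gamma_prime c v \<sigma> \<gamma> i ** gamma_prime c v \<sigma> \<gamma> j +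
        gamma_prime c v \<sigma> \<gamma> j ** gamma_prime c v \<sigma> \<gamma> i = - (\<gamma> i ** \<gamma> j + \<gamma> j ** \<gamma> i)"
    using assms by (simp add: gamma_prime_mult)
  also have "\<gamma> i ** \<gamma> j + \<gamma> j ** \<gamma> i = mat (2 * minkowski i j)"
    using assms by (simp add: dirac_matrices_def)
  also have "- mat (2 * minkowski i j) = (mat (if i = j then 2 else 0) :: complex ^ 4 ^ 4)"
    using assms by (simp add: minkowski_def mat_def vec_eq_iff)
  finally show ?thesis .
qed

text \<open>Averaging the double sum with its copy under exchange of i and j replaces each product
  by half an anticommutator, which leaves only the diagonal. In the application \<open>h\<close> is
  the Hessian of \<psi>.\<close>

lemma anticommuting_square_sum:
  fixes M :: "'i \<Rightarrow> complex ^ 'n ^ 'n" and h :: "'i \<Rightarrow> 'i \<Rightarrow> complex ^ 'n"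
  assumes "finite I"
    and M: "\<And>i j. i \<in> I \<Longrightarrow> j \<in> I \<Longrightarrow> M i ** M j + M j ** M i = mat (if i = j then 2 else 0)"
    and h: "\<And>i j. h i j = h j i"
  shows "(\<Sum>i\<in>I. \<Sum>j\<in>I. M i *v (M j *v h i j)) = (\<Sum>i\<in>I. h i i)" (is "?T = _")
proof -
  have "?T = (\<Sum>i\<in>I. \<Sum>j\<in>I. M j *v (M i *v h i j))"
    by (subst sum.swap) (simp add: h)
  then have "2 *\<^sub>R ?T = (\<Sum>i\<in>I. \<Sum>j\<in>I. (M i ** M j + M j ** M i) *v h i j)"
    by (simp add: scaleR_2 sum.distrib matrix_vector_mult_add_rdistrib matrix_vector_mul_assoc)
  also have "\<dots> = (\<Sum>i\<in>I. \<Sum>j\<in>I. if i = j then 2 *\<^sub>R h i i else 0)"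
  proof (intro sum.cong refl)
    fix i j assume "i \<in> I" "j \<in> I"
    have "mat 2 *v x = 2 *\<^sub>R x" for x :: "complex ^ 'n"
      by (simp add: matrix_vector_mult_def mat_def vec_eq_iff mult_delta_left scaleR_conv_of_real)
    then show "(M i ** M j + M j ** M i) *v h i j = (if i = j then 2 *\<^sub>R h i i else 0)"
      using M[OF \<open>i \<in> I\<close> \<open>j \<in> I\<close>] by simp
  qed
  also have "\<dots> = 2 *\<^sub>R (\<Sum>i\<in>I. h i i)"
    using \<open>finite I\<close> by (simp add: scaleR_sum_right)
  finally show ?thesis
    by simp
qed

section \<open>From the first-order system to the wave equation\<close>

theorem corollary3:
  fixes c v \<sigma> :: real
    and \<gamma> :: "4 \<Rightarrow> complex ^ 4 ^ 4"
    and X :: "real \<Rightarrow> real ^ 3"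
    and \<tau> :: "real \<Rightarrow> real"
    and \<psi> :: "real ^ 4 \<Rightarrow> complex ^ 4"
  assumes "c > 0" and "0 < v" and "v \<le> c"
    and "dirac_matrices \<gamma>"
    and "\<And>t. X differentiable at t" and "\<And>t. speed X t = v"
    and "proper_time c X \<tau>" and "\<And>t. (\<tau> has_real_derivative \<sigma>) (at t)"
    and "twice_continuously_differentiable \<psi>"
    and "\<And>p. (1 / v) *\<^sub>R partial 0 \<psi> p =
                - (\<Sum>i\<in>spatial. gamma_prime c v \<sigma> \<gamma> i *v partial i \<psi> p)"
  shows "\<forall>p. 0 = (1 / v\<^sup>2) *\<^sub>R partial 0 (partial 0 \<psi>) p
                - (\<Sum>i\<in>spatial. partial i (partial i \<psi>) p)"
proof
  fix p
  obtain D D2 where D: "\<And>p. (\<psi> has_derivative blinfun_apply (D p)) (at p)"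
    and D2: "\<And>p. (D has_derivative blinfun_apply (D2 p)) (at p)"
    using assms(9) unfolding twice_continuously_differentiable_def by blast
  \<comment> \<open>Speed and \<open>\<sigma>\<close> are constant, so the instant 0 already yields
    the relation between them.\<close>
  have v2: "v\<^sup>2 = (\<Sum>i\<in>UNIV. (deriv (\<lambda>s. X s $ i) 0)\<^sup>2)"
    using assms(6)[of 0] by (auto simp: speed_def sum_nonneg)
  have "deriv \<tau> 0 = \<sigma>"
    using assms(8) by (rule DERIV_imp_deriv)
  then have \<sigma>: "c\<^sup>2 * \<sigma>\<^sup>2 = c\<^sup>2 - v\<^sup>2"
    using assms(7) v2 unfolding proper_time_def by metis
  define M where "M = gamma_prime c v \<sigma> \<gamma>"
  define e where "e a = (axis a 1 :: real ^ 4)" for a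
  define h where "h a b = D2 p (e a) (e b)" for a b
  have p1: "partial a \<psi> = (\<lambda>q. D q (e a))" for a
    using partial_eq[OF D] by (simp add: e_def fun_eq_iff)
  have dD: "((\<lambda>q. D q (e a)) has_derivative (\<lambda>u. D2 p u (e a))) (at p)" for a
    by (rule bounded_linear.has_derivative[OF blinfun.bounded_linear_left D2])
  have p2: "partial a (partial b \<psi>) p = h a b" for a b
    unfolding p1 by (subst partial_eq[OF dD]) (simp add: h_def e_def)
  have h_sym: "h a b = h b a" for a b
    unfolding h_def by (rule second_derivative_symmetric[OF D D2])
  \<comment> \<open>The equation holds at every point, hence as an equality of functions of q; by
    uniqueness of derivatives it may be differentiated at p in every direction.\<close>
  have eq: "(\<lambda>q. (1 / v) *\<^sub>R D q (e 0)) = (\<lambda>q. - (\<Sum>i\<in>spatial. M i *v D q (e i)))"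
    using assms(10) by (simp add: p1 M_def fun_eq_iff)
  have "((\<lambda>q. (1 / v) *\<^sub>R D q (e 0)) has_derivative (\<lambda>u. (1 / v) *\<^sub>R D2 p u (e 0))) (at p)"
    by (intro derivative_intros dD)
  moreover have "((\<lambda>q. - (\<Sum>i\<in>spatial. M i *v D q (e i))) has_derivative
      (\<lambda>u. - (\<Sum>i\<in>spatial. M i *v D2 p u (e i)))) (at p)"
    by (intro derivative_intros bounded_linear.has_derivative[OF matrix_vector_mul_bounded_linear] dD)
  ultimately have "(\<lambda>u. (1 / v) *\<^sub>R D2 p u (e 0)) = (\<lambda>u. - (\<Sum>i\<in>spatial. M i *v D2 p u (e i)))"
    unfolding eq by (rule has_derivative_unique)
  then have diff: "(1 / v) *\<^sub>R h a 0 = - (\<Sum>i\<in>spatial. M i *v h a i)" for a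
    unfolding h_def by (rule fun_cong)
  have "(1 / v\<^sup>2) *\<^sub>R h 0 0 = (1 / v) *\<^sub>R ((1 / v) *\<^sub>R h 0 0)"
    by (simp add: power2_eq_square)
  also have "\<dots> = - (\<Sum>i\<in>spatial. M i *v ((1 / v) *\<^sub>R h 0 i))"
    by (subst diff) (simp add: scaleR_sum_right matrix_vector_mult_scaleR_right)
  \<comment> \<open>Symmetry turns \<open>h 0 i\<close> into \<open>h i 0\<close>, to which the
    differentiated equation applies again, now in direction \<open>e i\<close>.\<close>
  also have "\<dots> = - (\<Sum>i\<in>spatial. M i *v (- (\<Sum>j\<in>spatial. M j *v h i j)))"
    by (simp only: h_sym[of 0] diff)
  also have "\<dots> = (\<Sum>i\<in>spatial. \<Sum>j\<in>spatial. M i *v (M j *v h i j))"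
    by (simp add: linear_neg[OF matrix_vector_mul_linear] linear_sum[OF matrix_vector_mul_linear] sum_negf)
  also have "\<dots> = (\<Sum>i\<in>spatial. h i i)"
    unfolding M_def using assms \<sigma> h_sym
    by (intro anticommuting_square_sum gamma_prime_anticommute) (auto simp: spatial_def)
  finally show "0 = (1 / v\<^sup>2) *\<^sub>R partial 0 (partial 0 \<psi>) p
                - (\<Sum>i\<in>spatial. partial i (partial i \<psi>) p)"
    by (simp add: p2)
qed

end
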